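(* Let $\mathcal{F}_{pres}=\{f:\mathbb{R}_0^+\to\mathbb{R}_0^+\;;\; f\text{ is semi-metric-preserving}\}$. Then $(\mathcal{F}_{pres},+,\cdot)$ is a semi-vector space over $\mathbb{R}_0^+$, where $+$ is pointwise addition and $\cdot$ is pointwise multiplication by scalars in $\mathbb{R}_0^+$.
   Context: $\mathbb{R}_0^+=[0,\infty)$. A semi-metric on a set $X$ is a function $d:X\times X\to\mathbb{R}$ with $d(x,y)\ge 0$, $d(x,x)=0$, $d(x,y)=d(y,x)$ and $d(x,z)\le d(x,y)+d(y,z)$ for all $x,y,z\in X$ (i.e. a pseudometric). A function $f:\mathbb{R}_0^+\to\mathbb{R}_0^+$ is semi-metric-preserving if for every semi-metric space $(X,d)$ the composite $f\circ d$ is a semi-metric on $X$. A semi-vector space over $\mathbb{R}_0^+$ is a set $V$ with operations $+:V\times V\to V$ and $\cdot:\mathbb{R}_0^+\times V\to V$ such that: (1) $(V,+)$ is an abelian monoid satisfying the cancellation law $u+v=u+w\Rightarrow v=w$; (2) $\alpha(u+v)=\alpha u+\alpha v$; (3) $(\alpha+\beta)v=\alpha v+\beta v$; (4) $(\alpha\beta)v=\alpha(\beta v)$; (5) $1v=v$. *)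

theory Defs
  imports Complex_Main "HOL-Algebra.Module"
begin

(* A semi-metric is a pseudometric: distinct points may have distance 0. *)
definition semi_metric :: "'a set \<Rightarrow> ('a \<Rightarrow> 'a \<Rightarrow> real) \<Rightarrow> bool" where
  "semi_metric X d \<longleftrightarrow>
     (\<forall>x\<in>X. \<forall>y\<in>X. 0 \<le> d x y) \<and>
     (\<forall>x\<in>X. d x x = 0) \<and>
     (\<forall>x\<in>X. \<forall>y\<in>X. d x y = d y x) \<and>
     (\<forall>x\<in>X. \<forall>y\<in>X. \<forall>z\<in>X. d x z \<le> d x y + d y z)"

(* HOL cannot quantify over all types inside a formula, so the semi-metric spaces range over
   all subsets of a type 'a that is a parameter. The lemma below shows that the notion does not
   depend on the choice of 'a, as soon as 'a has three elements. *)
definition semi_metric_preserving :: "'a itself \<Rightarrow> (real \<Rightarrow> real) \<Rightarrow> bool" where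
  "semi_metric_preserving (_ :: 'a itself) f \<longleftrightarrow>
     (\<forall>(X :: 'a set) d. semi_metric X d \<longrightarrow> semi_metric X (\<lambda>x y. f (d x y)))"

lemma semi_metric_preserving_any_type:
  fixes a b c :: 'a
  assumes distinct: "a \<noteq> b" "a \<noteq> c" "b \<noteq> c"
    and f: "semi_metric_preserving TYPE('a) f"
  shows "semi_metric_preserving TYPE('b) f"
  unfolding semi_metric_preserving_def
proof (intro allI impI)
  fix X :: "'b set" and d assume d: "semi_metric X d"
  have *: "0 \<le> f (d x y) \<and> f (d x x) = 0 \<and> f (d x y) = f (d y x) \<and>
           f (d x z) \<le> f (d x y) + f (d y z)"
    if xyz: "x \<in> X" "y \<in> X" "z \<in> X" for x y z
  proof -
    define g where "g u = (if u = a then x else if u = b then y else z)" for u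
    have g: "g a = x" "g b = y" "g c = z"
      using distinct by (auto simp: g_def)
    have "g u \<in> X" for u
      using xyz by (simp add: g_def)
    then have "semi_metric UNIV (\<lambda>u v. d (g u) (g v))"
      using d unfolding semi_metric_def by blast
    then have "semi_metric UNIV (\<lambda>u v. f (d (g u) (g v)))"
      using f unfolding semi_metric_preserving_def by blast
    then show ?thesis
      unfolding semi_metric_def using g by (metis UNIV_I)
  qed
  show "semi_metric X (\<lambda>x y. f (d x y))"
    unfolding semi_metric_def using * by blast
qed

(* The scalars are the nonnegative reals. Only the additive part and the scalar multiplication
   of the module record are used. *)
locale semi_vector_space = abelian_monoid V for V :: "(real, 'v, 'm) module_scheme" (structure) +
  assumes add_cancel:
      "\<lbrakk>u \<in> carrier V; v \<in> carrier V; w \<in> carrier V; u \<oplus> v = u \<oplus> w\<rbrakk> \<Longrightarrow> v = w"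
    and smult_closed: "\<lbrakk>0 \<le> \<alpha>; v \<in> carrier V\<rbrakk> \<Longrightarrow> \<alpha> \<odot>\<^bsub>V\<^esub> v \<in> carrier V"
    and smult_add_right:
      "\<lbrakk>0 \<le> \<alpha>; u \<in> carrier V; v \<in> carrier V\<rbrakk> \<Longrightarrow>
        \<alpha> \<odot>\<^bsub>V\<^esub> (u \<oplus> v) = \<alpha> \<odot>\<^bsub>V\<^esub> u \<oplus> \<alpha> \<odot>\<^bsub>V\<^esub> v"
    and smult_add_left:
      "\<lbrakk>0 \<le> \<alpha>; 0 \<le> \<beta>; v \<in> carrier V\<rbrakk> \<Longrightarrow>
        (\<alpha> + \<beta>) \<odot>\<^bsub>V\<^esub> v = \<alpha> \<odot>\<^bsub>V\<^esub> v \<oplus> \<beta> \<odot>\<^bsub>V\<^esub> v"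
    and smult_assoc:
      "\<lbrakk>0 \<le> \<alpha>; 0 \<le> \<beta>; v \<in> carrier V\<rbrakk> \<Longrightarrow>
        (\<alpha> * \<beta>) \<odot>\<^bsub>V\<^esub> v = \<alpha> \<odot>\<^bsub>V\<^esub> (\<beta> \<odot>\<^bsub>V\<^esub> v)"
    and smult_one: "v \<in> carrier V \<Longrightarrow> 1 \<odot>\<^bsub>V\<^esub> v = v"

(* A function from [0, infinity) to itself is a function on the reals with the fixed value
   undefined off [0, infinity), so that HOL equality is equality of functions on [0, infinity);
   the restrictions below keep the operations among such functions. *)
definition F_pres :: "'a itself \<Rightarrow> (real, real \<Rightarrow> real) module" where
  "F_pres (_ :: 'a itself) =
     \<lparr>carrier = {f \<in> {0..} \<rightarrow>\<^sub>E {0..}. semi_metric_preserving TYPE('a) f},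
      mult = undefined,
      one = undefined,
      zero = (\<lambda>t\<in>{0..}. 0),
      add = (\<lambda>f g. \<lambda>t\<in>{0..}. f t + g t),
      smult = (\<lambda>\<alpha> f. \<lambda>t\<in>{0..}. \<alpha> * f t)\<rparr>"

end

theory Submission
  imports Defs
begin

text \<open>The semi-metrics on a fixed set form a convex cone: their axioms are linear equations
  and inequalities, which survive sums and nonnegative multiples (\<open>semi_metric_add\<close>,
  \<open>semi_metric_scale\<close>). For fixed \<open>d\<close>, the map sending \<open>f\<close> to
  its composite with \<open>d\<close> is linear, so the preserving functions form a cone as well
  (\<open>F_pres_closed\<close>). Every remaining axiom is an identity or a cancellation of real
  numbers at each point, and \<open>F_pres_eqI\<close> lifts it to functions. The argument treats
  one space at a time and hence works for every \<open>'a\<close>.\<close>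

lemma semi_metric_cong:
  assumes "\<And>x y. \<lbrakk>x \<in> X; y \<in> X\<rbrakk> \<Longrightarrow> d x y = e x y"
  shows "semi_metric X d \<longleftrightarrow> semi_metric X e"
  using assms by (simp add: semi_metric_def)

lemma semi_metric_zero: "semi_metric X (\<lambda>x y. 0)"
  by (simp add: semi_metric_def)

lemma semi_metric_add:
  assumes d: "semi_metric X d" and e: "semi_metric X e"
  shows "semi_metric X (\<lambda>x y. d x y + e x y)"
proof -
  have "d x z + e x z \<le> d x y + e x y + (d y z + e y z)"
    if "x \<in> X" "y \<in> X" "z \<in> X" for x y z
  proof -
    have "d x z \<le> d x y + d y z" "e x z \<le> e x y + e y z"
      using d e that by (simp_all add: semi_metric_def)
    then show ?thesis by linarith
  qed
  then show ?thesis
    using d e by (simp add: semi_metric_def)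
qed

text \<open>Multiplying an inequality by \<alpha> keeps its direction because \<alpha> is
  nonnegative; this is where the restriction to nonnegative scalars enters.\<close>

lemma semi_metric_scale:
  assumes d: "semi_metric X d" and "0 \<le> \<alpha>"
  shows "semi_metric X (\<lambda>x y. \<alpha> * d x y)"
proof -
  have "\<alpha> * d x z \<le> \<alpha> * d x y + \<alpha> * d y z"
    if "x \<in> X" "y \<in> X" "z \<in> X" for x y z
  proof -
    have "d x z \<le> d x y + d y z"
      using d that by (simp add: semi_metric_def)
    then show ?thesis
      using \<open>0 \<le> \<alpha>\<close> by (metis distrib_left mult_left_mono)
  qed
  then show ?thesis
    using assms by (simp add: semi_metric_def)
qed

text \<open>Distances are nonnegative, so \<open>f\<close> is only ever evaluated on
  \<open>{0..}\<close>. This strips the restrictions built into the operations of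
  \<open>F_pres\<close>.\<close>

lemma semi_metric_preserving_restrict:
  "semi_metric_preserving TYPE('a) (\<lambda>t\<in>{0..}. f t) \<longleftrightarrow> semi_metric_preserving TYPE('a) f"
proof -
  have "semi_metric X (\<lambda>x y. (\<lambda>t\<in>{0..}. f t) (d x y)) \<longleftrightarrow> semi_metric X (\<lambda>x y. f (d x y))"
    if "semi_metric X d" for X :: "'a set" and d
    using that by (intro semi_metric_cong) (simp add: semi_metric_def)
  then show ?thesis
    by (auto simp: semi_metric_preserving_def)
qed

lemma semi_metric_preserving_zero: "semi_metric_preserving TYPE('a) (\<lambda>t. 0)"
  by (simp add: semi_metric_preserving_def semi_metric_zero)

lemma semi_metric_preserving_add:
  assumes "semi_metric_preserving TYPE('a) f" "semi_metric_preserving TYPE('a) g"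
  shows "semi_metric_preserving TYPE('a) (\<lambda>t. f t + g t)"
  using assms by (simp add: semi_metric_preserving_def semi_metric_add)

lemma semi_metric_preserving_scale:
  assumes "semi_metric_preserving TYPE('a) f" "0 \<le> \<alpha>"
  shows "semi_metric_preserving TYPE('a) (\<lambda>t. \<alpha> * f t)"
  using assms by (simp add: semi_metric_preserving_def semi_metric_scale)

lemma in_carrier_F_pres_iff:
  "f \<in> carrier (F_pres TYPE('a)) \<longleftrightarrow>
     f \<in> {0..} \<rightarrow>\<^sub>E {0..} \<and> semi_metric_preserving TYPE('a) f"
  by (simp add: F_pres_def)

lemma F_pres_ops:
  "\<zero>\<^bsub>F_pres TYPE('a)\<^esub> = (\<lambda>t\<in>{0..}. 0)"
  "f \<oplus>\<^bsub>F_pres TYPE('a)\<^esub> g = (\<lambda>t\<in>{0..}. f t + g t)"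
  "\<alpha> \<odot>\<^bsub>F_pres TYPE('a)\<^esub> f = (\<lambda>t\<in>{0..}. \<alpha> * f t)"
  by (simp_all add: F_pres_def)

lemma F_pres_closed:
  "\<zero>\<^bsub>F_pres TYPE('a)\<^esub> \<in> carrier (F_pres TYPE('a))"
  "\<lbrakk>f \<in> carrier (F_pres TYPE('a)); g \<in> carrier (F_pres TYPE('a))\<rbrakk> \<Longrightarrow>
     f \<oplus>\<^bsub>F_pres TYPE('a)\<^esub> g \<in> carrier (F_pres TYPE('a))"
  "\<lbrakk>0 \<le> \<alpha>; f \<in> carrier (F_pres TYPE('a))\<rbrakk> \<Longrightarrow>
     \<alpha> \<odot>\<^bsub>F_pres TYPE('a)\<^esub> f \<in> carrier (F_pres TYPE('a))"
  unfolding in_carrier_F_pres_iff F_pres_ops semi_metric_preserving_restrict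
  by (auto simp: PiE_iff intro: semi_metric_preserving_zero semi_metric_preserving_add
      semi_metric_preserving_scale)

text \<open>Off \<open>{0..}\<close> both functions take the value \<open>undefined\<close>, so only
  nonnegative arguments need a check.\<close>

lemma F_pres_eqI:
  assumes "f \<in> carrier (F_pres TYPE('a))" "g \<in> carrier (F_pres TYPE('a))"
    and "\<And>t. 0 \<le> t \<Longrightarrow> f t = g t"
  shows "f = g"
  using assms by (auto simp: in_carrier_F_pres_iff intro: PiE_ext)

theorem theorem3p9: "semi_vector_space (F_pres TYPE('a))"
proof -
  \<comment> \<open>The conclusion \<open>f = g\<close> does not determine the type parameter, so it
    is fixed here.\<close>
  note eqI = F_pres_eqI[where 'a = 'a]
  interpret abelian_monoid "F_pres TYPE('a)"
  proof (intro abelian_monoidI, goal_cases)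
    case 1
    then show ?case by (rule F_pres_closed)
  next
    case 2
    show ?case by (rule F_pres_closed)
  next
    case 3
    then show ?case by (intro eqI F_pres_closed) (simp_all add: F_pres_ops)
  next
    case 4
    then show ?case by (intro eqI F_pres_closed) (simp_all add: F_pres_ops)
  next
    case 5
    then show ?case by (intro eqI F_pres_closed) (simp_all add: F_pres_ops)
  qed
  show ?thesis
  proof (unfold_locales, goal_cases)
    case (1 u v w)
    \<comment> \<open>Evaluating the equation of the two sums at \<open>t\<close> leaves
      cancellation of \<open>u t\<close> in the reals.\<close>
    have "v t = w t" if "0 \<le> t" for t
      using fun_cong[OF 1(4), of t] that by (simp add: F_pres_ops)
    with 1 show ?case
      by (intro eqI)
  next
    case 2
    then show ?case by (rule F_pres_closed)
  next
    case 3
    then show ?case by (intro eqI F_pres_closed) (simp_all add: F_pres_ops distrib_left)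
  next
    case 4
    then show ?case by (intro eqI F_pres_closed) (simp_all add: F_pres_ops distrib_right)
  next
    case 5
    then show ?case by (intro eqI F_pres_closed) (simp_all add: F_pres_ops)
  next
    case 6
    \<comment> \<open>The scalar multiple by 1 is a restriction of \<open>v\<close>; it equals
      \<open>v\<close> itself because \<open>v\<close>, being in the carrier, is already
      \<open>undefined\<close> off \<open>{0..}\<close>.\<close>
    then show ?case by (intro eqI F_pres_closed) (simp_all add: F_pres_ops)
  qed
qed

end
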